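(* For every odd $n\ge 3$ there exists an integer cyclically $3$-diagonal $\mathrm{H}_{2n}(n;3)$.
   Context: A partially filled (p.f.) array is a matrix in which some cells may be empty. Let $n\ge k\ge 3$, let $t$ divide $2nk$, put $v=2nk+t$ and let $J$ be the subgroup of $\mathbb{Z}_v$ of order $t$. An $\mathrm{H}_t(n;k)$ (square relative Heffter array) is an $n\times n$ p.f. array with elements in $\mathbb{Z}_v$ such that each row and each column has exactly $k$ filled cells; for every $x\in\mathbb{Z}_v\setminus J$ either $x$ or $-x$ appears in the array; and the elements of every row and column sum to $0$. It is integer if moreover the elements of every row and column, viewed as integers in $\pm\{1,\dots,\lfloor\frac{2nk+t}{2}\rfloor\}$, sum to $0$ in $\mathbb{Z}$. For an $n\times n$ array and $i\in\{1,\dots,n\}$, the $i$-th diagonal is $D_i=\{(i,1),(i+1,2),\dots,(i-1,n)\}$, indices taken modulo $n$ in $\{1,\dots,n\}$. Diagonals $D_i,D_{i+1},\dots,D_{i+r}$ (indices mod $n$) are consecutive. A p.f. array of size $n\ge k$ is cyclically $k$-diagonal if its nonempty cells are exactly those of $k$ consecutive diagonals. *)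

theory Defs
  imports "HOL-Algebra.Elementary_Groups" "HOL-Algebra.FiniteProduct"
begin

text \<open>
  Z_v is \<^const>\<open>integer_mod_group\<close> \<open>v\<close> (carrier \<open>{0..<v}\<close>, written multiplicatively: \<open>inv\<close> is
  negation, \<open>\<one>\<close> is 0 and \<^const>\<open>finprod\<close> is the sum in Z_v).  An \<open>n \<times> n\<close> partially filled array
  is a function of the row and column indices \<open>1..n\<close>, with \<^const>\<open>None\<close> for an empty cell; its
  values outside \<open>{1..n} \<times> {1..n}\<close> play no role.
\<close>

type_synonym 'a pf_array = "nat \<Rightarrow> nat \<Rightarrow> 'a option"

definition filled_cells :: "nat \<Rightarrow> 'a pf_array \<Rightarrow> (nat \<times> nat) set" where
  "filled_cells n A = {(i, j). i \<in> {1..n} \<and> j \<in> {1..n} \<and> A i j \<noteq> None}"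

definition row_cells :: "nat \<Rightarrow> 'a pf_array \<Rightarrow> nat \<Rightarrow> (nat \<times> nat) set" where
  "row_cells n A i = {c \<in> filled_cells n A. fst c = i}"

definition column_cells :: "nat \<Rightarrow> 'a pf_array \<Rightarrow> nat \<Rightarrow> (nat \<times> nat) set" where
  "column_cells n A j = {c \<in> filled_cells n A. snd c = j}"

definition cell_entry :: "'a pf_array \<Rightarrow> nat \<times> nat \<Rightarrow> 'a" where
  "cell_entry A c = the (A (fst c) (snd c))"

definition entries :: "nat \<Rightarrow> 'a pf_array \<Rightarrow> 'a set" where
  "entries n A = cell_entry A ` filled_cells n A"

text \<open>
  The subgroup \<open>J\<close> of order \<open>t\<close> of the cyclic group Z_v exists and is unique because \<open>t\<close> divides
  \<open>v = 2nk + t\<close>.  There are \<open>nk\<close> filled cells and \<open>2nk\<close> elements outside \<open>J\<close>, none of which is its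
  own negative, so the covering condition forces each pair \<open>x, -x\<close> outside \<open>J\<close> to occur in exactly
  one cell and no entry to lie in \<open>J\<close>; the exclusive reading of ``either \<open>x\<close> or \<open>-x\<close>'' used here
  is therefore equivalent to the inclusive one.
\<close>

definition relative_heffter :: "nat \<Rightarrow> nat \<Rightarrow> nat \<Rightarrow> int pf_array \<Rightarrow> bool" where
  "relative_heffter t n k A \<longleftrightarrow>
     3 \<le> k \<and> k \<le> n \<and> t dvd 2 * n * k \<and>
     (let Z = integer_mod_group (2 * n * k + t) in
        entries n A \<subseteq> carrier Z \<and>
        (\<forall>i\<in>{1..n}. card (row_cells n A i) = k) \<and>
        (\<forall>j\<in>{1..n}. card (column_cells n A j) = k) \<and>
        (\<exists>J. subgroup J Z \<and> card J = t \<and>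
             (\<forall>x\<in>carrier Z - J. (x \<in> entries n A) \<noteq> (inv\<^bsub>Z\<^esub> x \<in> entries n A))) \<and>
        (\<forall>i\<in>{1..n}. finprod Z (cell_entry A) (row_cells n A i) = \<one>\<^bsub>Z\<^esub>) \<and>
        (\<forall>j\<in>{1..n}. finprod Z (cell_entry A) (column_cells n A j) = \<one>\<^bsub>Z\<^esub>))"

text \<open>
  A residue modulo \<open>v\<close> viewed as an integer in \<open>\<plusminus>{1,\<dots>,\<lfloor>v/2\<rfloor>}\<close>.  This fails to be well defined only
  for the residues 0 and (for even \<open>v\<close>) \<open>v/2\<close>; both lie in \<open>J\<close>, so neither is an entry of a
  relative Heffter array.
\<close>

definition int_rep :: "nat \<Rightarrow> int \<Rightarrow> int" where
  "int_rep v x = (THE y. \<bar>y\<bar> \<in> {1..int (v div 2)} \<and> y mod int v = x)"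

lemma int_rep_eqI:
  assumes "y \<noteq> 0" and "2 * \<bar>y\<bar> < int v" and "y mod int v = x"
  shows "int_rep v x = y"
  unfolding int_rep_def
proof (rule the_equality)
  show "\<bar>y\<bar> \<in> {1..int (v div 2)} \<and> y mod int v = x"
    using assms by auto
next
  fix z assume z: "\<bar>z\<bar> \<in> {1..int (v div 2)} \<and> z mod int v = x"
  then have "int v dvd z - y"
    using assms(3) mod_eq_dvd_iff[of z "int v" y] by simp
  moreover have "\<bar>z - y\<bar> < int v"
    using z assms(2) by auto
  ultimately show "z = y"
    using zdvd_not_zless[of "\<bar>z - y\<bar>" "int v"] by auto
qed

definition integer_relative_heffter :: "nat \<Rightarrow> nat \<Rightarrow> nat \<Rightarrow> int pf_array \<Rightarrow> bool" where
  "integer_relative_heffter t n k A \<longleftrightarrow>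
     relative_heffter t n k A \<and>
     (\<forall>i\<in>{1..n}. (\<Sum>c\<in>row_cells n A i. int_rep (2 * n * k + t) (cell_entry A c)) = 0) \<and>
     (\<forall>j\<in>{1..n}. (\<Sum>c\<in>column_cells n A j. int_rep (2 * n * k + t) (cell_entry A c)) = 0)"

text \<open>The representative in \<open>{1..n}\<close> of a positive index modulo \<open>n\<close>.\<close>

definition cyc_index :: "nat \<Rightarrow> nat \<Rightarrow> nat" where
  "cyc_index n m = (m - 1) mod n + 1"

definition diagonal :: "nat \<Rightarrow> nat \<Rightarrow> (nat \<times> nat) set" where
  "diagonal n i = {(cyc_index n (i + j - 1), j) | j. j \<in> {1..n}}"

definition cyclically_diagonal :: "nat \<Rightarrow> nat \<Rightarrow> 'a pf_array \<Rightarrow> bool" where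
  "cyclically_diagonal n k A \<longleftrightarrow>
     k \<le> n \<and> (\<exists>i\<in>{1..n}. filled_cells n A = (\<Union>s<k. diagonal n (cyc_index n (i + s))))"

end

theory Submission
  imports Defs
begin

text \<open>
  Let $b_i$, $c_i$ and $a_i$ be the integers in the cells $(i, i+1)$, $(i+1, i)$ and $(i, i)$.
  Rows and columns sum to 0 iff $b_i - c_i$ is a constant $d$ and $a_i = -(c_i + c_{i-1} + d)$.  Take
  $d = 4$ and $c_i = 8 e_i - 4n + 1$, where $e$ is the permutation
  $0, m + 1, 1, m + 2, \dots, 2m, m$ of $\{0, \dots, n - 1\}$, $n = 2m + 1$: the sums of cyclically
  consecutive terms of $e$ are $m, m + 1, \dots, 3m$, so that $a_i = 4n + 6 - 8i$.  As $n$ is odd,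
  modulo $8n$ the $b_i$, $c_i$ and $a_i$ are exactly the residues congruent to 1, 5 and 2 modulo 8,
  and their negatives are those congruent to 7, 3 and 6; the rest is the subgroup of multiples of 4.
\<close>

section \<open>Sums, residue classes and subgroups in Z_v\<close>

lemma finprod_integer_mod_group:
  assumes "finite S"
  shows "finprod (integer_mod_group v) (\<lambda>c. f c mod int v) S = sum f S mod int v"
proof -
  interpret Z: comm_group "integer_mod_group v"
    by (rule abelian_integer_mod_group)
  have closed: "x mod int v \<in> carrier (integer_mod_group v)" for x
    by (simp add: carrier_integer_mod_group)
  show ?thesis
    using assms
  proof (induction S)
    case empty
    then show ?case by simp
  next
    case (insert c S)
    then have "finprod (integer_mod_group v) (\<lambda>c. f c mod int v) (insert c S) =
        f c mod int v \<otimes>\<^bsub>integer_mod_group v\<^esub> (sum f S mod int v)"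
      using closed by (subst Z.finprod_insert) auto
    with insert show ?case
      by (simp add: mult_integer_mod_group mod_add_eq)
  qed
qed

text \<open>Reduction modulo \<open>k * n\<close> keeps the class modulo \<open>k\<close>, and a
  quotient by \<open>k\<close> matters only modulo \<open>n\<close>. This turns a permutation of
  \<open>{0..<n}\<close> into a full residue class modulo 8.\<close>

lemma image_mod_multiples:
  fixes s :: int
  assumes "k > 0" "n > 0"
  shows "(\<lambda>q. (k * q + s) mod (k * n)) ` {0..<n} = {x \<in> {0..<k * n}. x mod k = s mod k}"
    (is "?L = ?R")
proof
  show "?L \<subseteq> ?R"
    using assms by (auto simp: mod_mod_cancel)
next
  show "?R \<subseteq> ?L"
  proof
    fix x assume x: "x \<in> ?R"
    then have "k dvd x - s"
      by (simp add: mod_eq_dvd_iff)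
    then obtain r where r: "x = k * r + s"
      by (metis dvdE diff_add_cancel)
    \<comment> \<open>The quotient \<open>r\<close> need not lie in \<open>{0..<n}\<close>; its
      remainder modulo \<open>n\<close> gives the same residue and serves as the preimage.\<close>
    have "k * (r mod n) = k * r mod (k * n)"
      by (simp add: mod_mult_mult1)
    then have "(k * (r mod n) + s) mod (k * n) = x mod (k * n)"
      by (metis mod_add_left_eq r)
    then show "x \<in> ?L"
      using x assms by (intro image_eqI[of _ _ "r mod n"]) auto
  qed
qed

text \<open>Supplies the subgroup J of order \<open>2 * n\<close> in Z_8n, with \<open>k = 4\<close>
  and \<open>t = 2 * n\<close>.\<close>

lemma subgroup_multiples_integer_mod_group:
  assumes "k > 0" "t > 0"
  shows "subgroup {x \<in> {0..<int (k * t)}. int k dvd x} (integer_mod_group (k * t))"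
    and "card {x \<in> {0..<int (k * t)}. int k dvd x} = t"
proof -
  have pos: "0 < int (k * t)"
    using assms by simp
  show "subgroup {x \<in> {0..<int (k * t)}. int k dvd x} (integer_mod_group (k * t))"
  proof (rule group.subgroupI[OF group_integer_mod_group])
    show "{x \<in> {0..<int (k * t)}. int k dvd x} \<subseteq> carrier (integer_mod_group (k * t))"
      using assms by (auto simp: carrier_integer_mod_group)
    show "{x \<in> {0..<int (k * t)}. int k dvd x} \<noteq> {}"
      using pos by force
  next
    fix x assume "x \<in> {x \<in> {0..<int (k * t)}. int k dvd x}"
    then show "inv\<^bsub>integer_mod_group (k * t)\<^esub> x \<in> {x \<in> {0..<int (k * t)}. int k dvd x}"
      using assms pos
      by (auto simp: inv_integer_mod_group carrier_integer_mod_group dvd_mod)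
  next
    fix x y
    assume "x \<in> {x \<in> {0..<int (k * t)}. int k dvd x}" "y \<in> {x \<in> {0..<int (k * t)}. int k dvd x}"
    then show "x \<otimes>\<^bsub>integer_mod_group (k * t)\<^esub> y \<in> {x \<in> {0..<int (k * t)}. int k dvd x}"
      using pos by (auto simp: mult_integer_mod_group dvd_mod)
  qed
  have "{x \<in> {0..<int (k * t)}. int k dvd x} = (\<lambda>q. int k * q) ` {0..<int t}"
    using assms by (auto simp: zero_le_mult_iff elim!: dvdE)
  then show "card {x \<in> {0..<int (k * t)}. int k dvd x} = t"
    using assms by (simp add: card_image inj_on_def)
qed

section \<open>Construction of the array\<close>

definition cyc_next :: "nat \<Rightarrow> nat \<Rightarrow> nat" where
  "cyc_next n i = (if i = n then 1 else i + 1)"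

definition cyc_prev :: "nat \<Rightarrow> nat \<Rightarrow> nat" where
  "cyc_prev n i = (if i = 1 then n else i - 1)"

text \<open>For odd \<open>n\<close> and \<open>i\<close> in \<open>{1..n}\<close> this is (i - 1)/2
  computed modulo \<open>n\<close>, the term e_i of the permutation.\<close>

definition zigzag :: "nat \<Rightarrow> nat \<Rightarrow> nat" where
  "zigzag n i = (if odd i then (i - 1) div 2 else (i - 1 + n) div 2)"

text \<open>The branches are a_i, b_i and c_i. The last one is indexed by the column, since c_i sits
  in row i + 1 and column i.\<close>

definition signed_entry :: "nat \<Rightarrow> nat \<times> nat \<Rightarrow> int" where
  "signed_entry n c =
     (if snd c = fst c then 4 * int n + 6 - 8 * int (fst c)
      else if snd c = cyc_next n (fst c) then 8 * int (zigzag n (fst c)) - 4 * int n + 5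
      else 8 * int (zigzag n (snd c)) - 4 * int n + 1)"

definition heffter3 :: "nat \<Rightarrow> int pf_array" where
  "heffter3 n i j =
     (if j \<in> {i, cyc_next n i, cyc_prev n i} then Some (signed_entry n (i, j) mod (8 * int n))
      else None)"

section \<open>Positions of the filled cells\<close>

context
  fixes n :: nat
  assumes odd_n: "odd n" and n3: "n \<ge> 3"
begin

lemma cyc_neighbours:
  assumes "i \<in> {1..n}"
  shows "cyc_next n i \<in> {1..n}" "cyc_prev n i \<in> {1..n}"
    "cyc_next n i \<noteq> i" "cyc_prev n i \<noteq> i" "cyc_next n i \<noteq> cyc_prev n i"
    "cyc_next n (cyc_prev n i) = i" "cyc_prev n (cyc_next n i) = i"
  using assms n3 by (auto simp: cyc_next_def cyc_prev_def split: if_splits)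

lemma filled_heffter3:
  "filled_cells n (heffter3 n) =
     {(i, j). i \<in> {1..n} \<and> j \<in> {i, cyc_next n i, cyc_prev n i}}"
  by (auto simp: filled_cells_def heffter3_def cyc_next_def cyc_prev_def split: if_splits)

text \<open>Successor and predecessor are inverse bijections, so the superdiagonal can be listed by
  rows, as the entries are, or by columns, as \<open>diagonal\<close> is.\<close>

lemma superdiagonal_eq:
  "(\<lambda>j. (cyc_prev n j, j)) ` {1..n} = (\<lambda>i. (i, cyc_next n i)) ` {1..n}" (is "?L = ?R")
proof
  show "?L \<subseteq> ?R"
  proof
    fix c assume "c \<in> ?L"
    then obtain j where "j \<in> {1..n}" "c = (cyc_prev n j, j)"
      by blast
    then show "c \<in> ?R"
      using cyc_neighbours[of j] by (intro image_eqI[of _ _ "cyc_prev n j"]) simp_all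
  qed
  show "?R \<subseteq> ?L"
  proof
    fix c assume "c \<in> ?R"
    then obtain i where "i \<in> {1..n}" "c = (i, cyc_next n i)"
      by blast
    then show "c \<in> ?L"
      using cyc_neighbours[of i] by (intro image_eqI[of _ _ "cyc_next n i"]) simp_all
  qed
qed

lemma filled_heffter3_diagonals:
  "filled_cells n (heffter3 n) =
     (\<lambda>i. (i, i)) ` {1..n} \<union> (\<lambda>i. (i, cyc_next n i)) ` {1..n} \<union> (\<lambda>j. (cyc_next n j, j)) ` {1..n}"
proof -
  have "filled_cells n (heffter3 n) =
      (\<lambda>i. (i, i)) ` {1..n} \<union> (\<lambda>i. (i, cyc_next n i)) ` {1..n} \<union> (\<lambda>i. (i, cyc_prev n i)) ` {1..n}"
    unfolding filled_heffter3 by blast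
  \<comment> \<open>The subdiagonal is the transpose of the superdiagonal, so the same change of
    parameter applies to it.\<close>
  moreover have "(\<lambda>i. (i, cyc_prev n i)) ` {1..n} = prod.swap ` ((\<lambda>j. (cyc_prev n j, j)) ` {1..n})"
    by (simp only: image_image prod.swap_def fst_conv snd_conv)
  then have "(\<lambda>i. (i, cyc_prev n i)) ` {1..n} = (\<lambda>j. (cyc_next n j, j)) ` {1..n}"
    by (simp only: superdiagonal_eq image_image prod.swap_def fst_conv snd_conv)
  ultimately show ?thesis
    by simp
qed

lemma row_heffter3:
  assumes "i \<in> {1..n}"
  shows "row_cells n (heffter3 n) i = {(i, i), (i, cyc_next n i), (i, cyc_prev n i)}"
  using assms by (auto simp: row_cells_def filled_heffter3)

lemma column_heffter3:
  assumes "j \<in> {1..n}"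
  shows "column_cells n (heffter3 n) j = {(j, j), (cyc_prev n j, j), (cyc_next n j, j)}"
proof -
  \<comment> \<open>Cyclic adjacency is symmetric, with successor and predecessor exchanged.\<close>
  have iff: "i \<in> {1..n} \<and> j \<in> {i, cyc_next n i, cyc_prev n i} \<longleftrightarrow>
      i \<in> {j, cyc_prev n j, cyc_next n j}" for i
    using assms n3 by (auto simp: cyc_next_def cyc_prev_def split: if_splits)
  have "column_cells n (heffter3 n) j =
      (\<lambda>i. (i, j)) ` {i. i \<in> {1..n} \<and> j \<in> {i, cyc_next n i, cyc_prev n i}}"
    by (auto simp: column_cells_def filled_heffter3)
  also have "\<dots> = {(j, j), (cyc_prev n j, j), (cyc_next n j, j)}"
    unfolding iff by blast
  finally show ?thesis .
qed

lemma cell_entry_heffter3: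
  assumes "c \<in> filled_cells n (heffter3 n)"
  shows "cell_entry (heffter3 n) c = signed_entry n c mod (8 * int n)"
  using assms by (auto simp: filled_heffter3 cell_entry_def heffter3_def)

section \<open>The zigzag permutation\<close>

lemma zigzag_lt: "i \<in> {1..n} \<Longrightarrow> zigzag n i < n"
  by (auto simp: zigzag_def)

lemma zigzag_image: "zigzag n ` {1..n} = {..<n}"
proof
  show "zigzag n ` {1..n} \<subseteq> {..<n}"
    using zigzag_lt by auto
  show "{..<n} \<subseteq> zigzag n ` {1..n}"
  proof
    fix k assume k: "k \<in> {..<n}"
    \<comment> \<open>The solution in \<open>{1..n}\<close> of i - 1 = 2k modulo \<open>n\<close>;
      as \<open>n\<close> is odd, the first case yields odd and the second even
      \<open>i\<close>.\<close>
    define i where "i = (if 2 * k < n then 2 * k + 1 else 2 * k + 1 - n)"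
    have "i \<in> {1..n}" "zigzag n i = k"
      using k odd_n by (auto simp: i_def zigzag_def)
    then show "k \<in> zigzag n ` {1..n}"
      by blast
  qed
qed

text \<open>Of two consecutive indices exactly one is even and contributes the summand
  \<open>n\<close>. At the wrap-around \<open>i = 1\<close> both are odd, and the index
  \<open>n\<close> itself contributes n - 1. Doubling avoids the halves.\<close>

lemma zigzag_consecutive:
  assumes "i \<in> {1..n}"
  shows "2 * (int (zigzag n i) + int (zigzag n (cyc_prev n i))) = int n + 2 * int i - 3"
proof -
  obtain m where m: "n = 2 * m + 1"
    using odd_n by (auto elim: oddE)
  show ?thesis
  proof (cases "odd i")
    case True
    then obtain l where "i = 2 * l + 1"
      by (auto elim: oddE)
    then show ?thesis
      \<comment> \<open>The case \<open>l = 0\<close> isolates the wrap-around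
        \<open>i = 1\<close>.\<close>
      using assms m by (cases l) (auto simp: zigzag_def cyc_prev_def)
  next
    case False
    then obtain l where "i = 2 * l"
      by (auto elim: evenE)
    then show ?thesis
      using assms m by (cases l) (auto simp: zigzag_def cyc_prev_def)
  qed
qed

section \<open>Signed values and their zero sums\<close>

lemma signed_entry_simps:
  assumes "i \<in> {1..n}"
  shows "signed_entry n (i, i) = 4 * int n + 6 - 8 * int i"
    "signed_entry n (i, cyc_next n i) = 8 * int (zigzag n i) - 4 * int n + 5"
    "signed_entry n (i, cyc_prev n i) = 8 * int (zigzag n (cyc_prev n i)) - 4 * int n + 1"
    "signed_entry n (cyc_prev n i, i) = 8 * int (zigzag n (cyc_prev n i)) - 4 * int n + 5"
    "signed_entry n (cyc_next n i, i) = 8 * int (zigzag n i) - 4 * int n + 1"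
proof -
  \<comment> \<open>Keeps the cell below the diagonal out of the superdiagonal branch of
    \<open>signed_entry\<close>; two successor steps do not return to \<open>i\<close> because
    \<open>n\<close> is at least 3.\<close>
  have "i \<noteq> cyc_next n (cyc_next n i)"
    using cyc_neighbours(5)[OF cyc_neighbours(1)[OF assms]] cyc_neighbours(7)[OF assms] by simp
  then show "signed_entry n (cyc_next n i, i) = 8 * int (zigzag n i) - 4 * int n + 1"
    using cyc_neighbours(3)[OF assms, symmetric] by (simp add: signed_entry_def)
qed (use cyc_neighbours(3-6)[OF assms] in \<open>simp_all add: signed_entry_def eq_commute[of i]\<close>)

text \<open>The sum a_i + b_i + c_(i-1) is 12 - 4n - 8i + 8(e_i + e_(i-1)), which vanishes by
  \<open>zigzag_consecutive\<close>. A column gives a_j + b_(j-1) + c_j, the same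
  expression.\<close>

lemma sum_row_heffter3:
  assumes "i \<in> {1..n}"
  shows "sum (signed_entry n) (row_cells n (heffter3 n) i) = 0"
  using assms cyc_neighbours[OF assms] zigzag_consecutive[OF assms]
  by (simp add: row_heffter3 signed_entry_simps)

lemma sum_column_heffter3:
  assumes "j \<in> {1..n}"
  shows "sum (signed_entry n) (column_cells n (heffter3 n) j) = 0"
  using assms cyc_neighbours[OF assms] zigzag_consecutive[OF assms]
  by (simp add: column_heffter3 signed_entry_simps)

lemma int_rep_heffter3:
  assumes "c \<in> filled_cells n (heffter3 n)"
  shows "int_rep (8 * n) (cell_entry (heffter3 n) c) = signed_entry n c"
proof (rule int_rep_eqI)
  show "signed_entry n c mod int (8 * n) = cell_entry (heffter3 n) c"
    using assms by (simp add: cell_entry_heffter3)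
  obtain i j where c: "c = (i, j)" and i: "i \<in> {1..n}"
    and j: "j = i \<or> j = cyc_next n i \<or> j = cyc_prev n i"
    using assms by (auto simp: filled_heffter3)
  note bounds = zigzag_lt[OF i] zigzag_lt[OF cyc_neighbours(2)[OF i]]
  \<comment> \<open>The diagonal values are 2 modulo 4, the others 1 modulo 4.\<close>
  have "\<not> 4 dvd signed_entry n c"
    using j i by (elim disjE) (simp_all add: c signed_entry_simps, presburger+)
  then show "signed_entry n c \<noteq> 0"
    by auto
  show "2 * \<bar>signed_entry n c\<bar> < int (8 * n)"
    using j i bounds by (elim disjE) (auto simp: c signed_entry_simps)
qed

section \<open>The set of entries, diagonal by diagonal\<close>

lemma entries_heffter3:
  "entries n (heffter3 n) = {x \<in> {0..<8 * int n}. x mod 8 \<in> {1, 2, 5}}"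
proof -
  let ?R = "\<lambda>s. {x \<in> {0..<8 * int n}. x mod 8 = s}"
  let ?f = "\<lambda>s q. (8 * q + s) mod (8 * int n)"
  have int_image: "int ` {..<n} = {0..<int n}"
    by (simp add: image_int_atLeastLessThan lessThan_atLeast0)
  have n0: "int n > 0"
    using n3 by simp
  obtain m where m: "n = 2 * m + 1"
    using odd_n by (auto elim: oddE)
  \<comment> \<open>Each diagonal has the form 8q + s with one of these offsets s; for odd
    \<open>n\<close>, 4n is 4 modulo 8.\<close>
  have mods: "(6 - 4 * int n) mod 8 = 2" "(5 - 4 * int n) mod 8 = 1" "(1 - 4 * int n) mod 8 = 5"
    using m by presburger+
  have D: "(\<lambda>i. signed_entry n (i, i) mod (8 * int n)) ` {1..n} = ?R 2"
  proof -
    \<comment> \<open>Writing a_i = 8(n - i) + 6 - 4n, the multiplier \<open>n - i\<close> runs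
      through \<open>{0..<n}\<close>.\<close>
    have "(\<lambda>i. int (n - i)) ` {1..n} = {0..<int n}"
    proof -
      have "(\<lambda>i. n - i) ` {1..n} = {..<n}"
      proof
        show "{..<n} \<subseteq> (\<lambda>i. n - i) ` {1..n}"
        proof
          fix k assume "k \<in> {..<n}"
          then show "k \<in> (\<lambda>i. n - i) ` {1..n}"
            by (intro image_eqI[of _ _ "n - k"]) auto
        qed
      qed auto
      then show ?thesis
        by (metis image_image int_image)
    qed
    then have "?f (6 - 4 * int n) ` {0..<int n} = (\<lambda>i. ?f (6 - 4 * int n) (int (n - i))) ` {1..n}"
      by (metis (no_types, lifting) image_cong image_image)
    also have "\<dots> = (\<lambda>i. signed_entry n (i, i) mod (8 * int n)) ` {1..n}"
      by (rule image_cong) (auto simp: signed_entry_simps of_nat_diff algebra_simps)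
    finally show ?thesis
      using image_mod_multiples[of 8 "int n" "6 - 4 * int n"] n0 mods by simp
  qed
  have Z: "(\<lambda>i. ?f s (int (zigzag n i))) ` {1..n} = ?R (s mod 8)" for s
  proof -
    have "(\<lambda>i. ?f s (int (zigzag n i))) ` {1..n} = ?f s ` (int ` (zigzag n ` {1..n}))"
      by (simp add: image_image)
    then show ?thesis
      using image_mod_multiples[of 8 "int n" s] n0 unfolding zigzag_image int_image by simp
  qed
  have "(\<lambda>i. signed_entry n (i, cyc_next n i) mod (8 * int n)) ` {1..n} =
      (\<lambda>i. ?f (5 - 4 * int n) (int (zigzag n i))) ` {1..n}"
    by (rule image_cong) (simp_all add: signed_entry_simps algebra_simps)
  then have N: "(\<lambda>i. signed_entry n (i, cyc_next n i) mod (8 * int n)) ` {1..n} = ?R 1"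
    by (simp only: Z mods)
  have "(\<lambda>i. signed_entry n (cyc_next n i, i) mod (8 * int n)) ` {1..n} =
      (\<lambda>i. ?f (1 - 4 * int n) (int (zigzag n i))) ` {1..n}"
    by (rule image_cong) (simp_all add: signed_entry_simps algebra_simps)
  then have P: "(\<lambda>i. signed_entry n (cyc_next n i, i) mod (8 * int n)) ` {1..n} = ?R 5"
    by (simp only: Z mods)
  have "entries n (heffter3 n) =
      (\<lambda>c. signed_entry n c mod (8 * int n)) ` filled_cells n (heffter3 n)"
    unfolding entries_def by (rule image_cong) (simp_all add: cell_entry_heffter3)
  then have "entries n (heffter3 n) = ?R 2 \<union> ?R 1 \<union> ?R 5"
    by (simp only: filled_heffter3_diagonals image_Un image_image D N P)
  then show ?thesis
    by auto
qed

section \<open>Verification of the Heffter and diagonal conditions\<close>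

lemma relative_heffter_heffter3: "relative_heffter (2 * n) n 3 (heffter3 n)"
proof -
  have v: "2 * n * 3 + 2 * n = 8 * n"
    by simp
  let ?Z = "integer_mod_group (8 * n)"
  have carrier: "carrier ?Z = {0..<8 * int n}"
    using n3 by (simp add: carrier_integer_mod_group)
  define J where "J = {x \<in> {0..<8 * int n}. 4 dvd x}"
  have J: "subgroup J ?Z" "card J = 2 * n"
    using subgroup_multiples_integer_mod_group[of 4 "2 * n"] n3 by (simp_all add: J_def)
  have "(x \<in> entries n (heffter3 n)) \<noteq> (inv\<^bsub>?Z\<^esub> x \<in> entries n (heffter3 n))"
    if x: "x \<in> carrier ?Z - J" for x
  proof -
    have "inv\<^bsub>?Z\<^esub> x = (- x) mod (8 * int n)"
      using x by (simp add: inv_integer_mod_group carrier)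
    moreover have "(- x) mod (8 * int n) mod 8 = (- x) mod 8"
      by (simp add: mod_mod_cancel)
    moreover have "(- x) mod (8 * int n) \<in> {0..<8 * int n}"
      using n3 by simp
    moreover have "x \<in> {0..<8 * int n}" "\<not> 4 dvd x"
      using x by (auto simp: carrier J_def)
    \<comment> \<open>Outside J, negation pairs the classes 1 and 7, 2 and 6, 5 and 3 modulo 8, and
      one class of each pair is filled.\<close>
    then have "(x mod 8 \<in> {1, 2, 5}) \<noteq> ((- x) mod 8 \<in> {1, 2, 5})"
      by simp presburger
    ultimately show ?thesis
      using \<open>x \<in> {0..<8 * int n}\<close> by (simp add: entries_heffter3)
  qed
  \<comment> \<open>One argument for rows and columns: a vanishing integer sum reduces to the
    identity of Z_8n.\<close>
  moreover have "finprod ?Z (cell_entry (heffter3 n)) S = \<one>\<^bsub>?Z\<^esub>"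
    if S: "S \<subseteq> filled_cells n (heffter3 n)" and sum: "sum (signed_entry n) S = 0" for S
  proof -
    interpret Z: comm_group ?Z
      by (rule abelian_integer_mod_group)
    have "finite (filled_cells n (heffter3 n))"
      by (rule finite_subset[of _ "{1..n} \<times> {1..n}"]) (auto simp: filled_cells_def)
    then have "finite S"
      using S finite_subset by blast
    have "finprod ?Z (cell_entry (heffter3 n)) S =
        finprod ?Z (\<lambda>c. signed_entry n c mod int (8 * n)) S"
      using S n3 cell_entry_heffter3 by (intro Z.finprod_cong') (auto simp: carrier)
    then show ?thesis
      using finprod_integer_mod_group[OF \<open>finite S\<close>, of "8 * n" "signed_entry n"] sum by simp
  qed
  moreover have "row_cells n (heffter3 n) i \<subseteq> filled_cells n (heffter3 n)"
    "column_cells n (heffter3 n) i \<subseteq> filled_cells n (heffter3 n)" for i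
    by (auto simp: row_cells_def column_cells_def)
  moreover have "card (row_cells n (heffter3 n) i) = 3" "card (column_cells n (heffter3 n) i) = 3"
    if "i \<in> {1..n}" for i
    using that cyc_neighbours[OF that] by (simp_all add: row_heffter3 column_heffter3)
  moreover have "entries n (heffter3 n) \<subseteq> carrier ?Z"
    by (auto simp: entries_heffter3 carrier)
  ultimately show ?thesis
    using J n3 sum_row_heffter3 sum_column_heffter3
    unfolding relative_heffter_def v Let_def by auto
qed

lemma integer_relative_heffter_heffter3: "integer_relative_heffter (2 * n) n 3 (heffter3 n)"
proof -
  have v: "2 * n * 3 + 2 * n = 8 * n"
    by simp
  have "(\<Sum>c\<in>S. int_rep (8 * n) (cell_entry (heffter3 n) c)) = sum (signed_entry n) S"
    if "S \<subseteq> filled_cells n (heffter3 n)" for S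
    using that int_rep_heffter3 by (intro sum.cong) auto
  moreover have "row_cells n (heffter3 n) i \<subseteq> filled_cells n (heffter3 n)"
    "column_cells n (heffter3 n) i \<subseteq> filled_cells n (heffter3 n)" for i
    by (auto simp: row_cells_def column_cells_def)
  ultimately show ?thesis
    using relative_heffter_heffter3 sum_row_heffter3 sum_column_heffter3
    unfolding integer_relative_heffter_def v by simp
qed

lemma cyclically_diagonal_heffter3: "cyclically_diagonal n 3 (heffter3 n)"
proof -
  have D: "diagonal n 1 = (\<lambda>j. (j, j)) ` {1..n}"
    by (auto simp: diagonal_def cyc_index_def image_def)
  \<comment> \<open>D_2 is the subdiagonal and D_n the superdiagonal, so the three consecutive
    diagonals start at D_n and wrap around to D_1 and D_2.\<close>
  have "cyc_index n (2 + j - 1) = cyc_next n j" "cyc_index n (n + j - 1) = cyc_prev n j"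
    if "j \<in> {1..n}" for j
    using that n3 by (auto simp: cyc_index_def cyc_next_def cyc_prev_def mod_if)
  then have N: "diagonal n 2 = (\<lambda>j. (cyc_next n j, j)) ` {1..n}"
    and "diagonal n n = (\<lambda>j. (cyc_prev n j, j)) ` {1..n}"
    by (force simp: diagonal_def)+
  then have P: "diagonal n n = (\<lambda>i. (i, cyc_next n i)) ` {1..n}"
    by (simp only: superdiagonal_eq)
  have "cyc_index n (n + 0) = n" "cyc_index n (n + 1) = 1" "cyc_index n (n + 2) = 2"
    using n3 by (auto simp: cyc_index_def mod_if)
  moreover have "{..<3} = {0, 1, 2 :: nat}"
    by auto
  ultimately have "(\<Union>s<3. diagonal n (cyc_index n (n + s))) =
      diagonal n n \<union> diagonal n 1 \<union> diagonal n 2"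
    by auto
  also have "\<dots> = filled_cells n (heffter3 n)"
    unfolding D N P filled_heffter3_diagonals by blast
  finally show ?thesis
    using n3 unfolding cyclically_diagonal_def by (intro conjI bexI[of _ n]) auto
qed

end

theorem proposition4p3:
  fixes n :: nat
  assumes "odd n" and "n \<ge> 3"
  shows "\<exists>A. integer_relative_heffter (2 * n) n 3 A \<and> cyclically_diagonal n 3 A"
  using assms integer_relative_heffter_heffter3 cyclically_diagonal_heffter3 by blast

end
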